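(* Let $q$ be a prime power and let $n,t,r$ be integers with $n>t>r\geq 0$ and $r\equiv n\pmod t$. Let $c_1$ be the integer with $c_1\equiv t-2\pmod q$ and $0\leq c_1<q$, and let \[ c_2=\begin{cases} q & \text{if } q^2\mid \big((q-1)(t-2)+c_1\big),\\ 0 & \text{if } q^2\nmid \big((q-1)(t-2)+c_1\big).\end{cases} \] If $2\leq r<t\leq \Theta_r$, then \[ \mu_q(n,t)\leq \frac{q^n-q^{t+r}}{q^t-1}+q^r-(q-1)(t-2)-c_1+c_2 . \] Consequently, \[ \mu_q(n,t)\leq \frac{q^n-q^{t+r}}{q^t-1}+q^r-(q-1)(t-3)+1 . \]
   Context: For an integer $i\geq 1$, $\Theta_i=(q^i-1)/(q-1)$. Let $\mathrm{PG}(n-1,q)$ denote the $(n-1)$-dimensional projective space over the finite field $\mathbb{F}_q$. A partial $(t-1)$-spread of $\mathrm{PG}(n-1,q)$ is a collection of (projective) $(t-1)$-dimensional subspaces of $\mathrm{PG}(n-1,q)$ that are pairwise disjoint; equivalently, a collection of $t$-dimensional vector subspaces of $\mathbb{F}_q^n$ that pairwise intersect only in $0$. $\mu_q(n,t)$ denotes the maximum size of any partial $(t-1)$-spread of $\mathrm{PG}(n-1,q)$. *)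

theory Defs
  imports "HOL-Analysis.Analysis" "HOL-Number_Theory.Number_Theory"
begin

definition Theta :: "nat \<Rightarrow> nat \<Rightarrow> real" where
  "Theta q i = (real q ^ i - 1) / (real q - 1)"

(* The finite field F_q is a type 'a of classes field and finite, and F_q^n is 'a ^ 'n with
   CARD('n) = n.  Projective subspaces of dimension t - 1 are the vector subspaces of
   dimension t, and they are disjoint iff the vector subspaces meet only in 0. *)
definition partial_spread :: "nat \<Rightarrow> ('a::field ^ 'n) set set \<Rightarrow> bool" where
  "partial_spread t S \<longleftrightarrow>
     (\<forall>U\<in>S. vec.subspace U \<and> vec.dim U = t) \<and> pairwise (\<lambda>U V. U \<inter> V = {0}) S"

(* The value mu_q(n,t), where q = CARD('a) and n = CARD('n). *)
definition mu :: "('a::{field,finite}) itself \<Rightarrow> ('n::finite) itself \<Rightarrow> nat \<Rightarrow> nat" where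
  "mu _ _ t = Max {card S |S :: ('a ^ 'n) set set. partial_spread t S}"

lemma partial_spread_empty: "partial_spread t {}"
  by (simp add: partial_spread_def)

(* The maximum ranges over a finite nonempty set, so it is attained and bounds every
   partial spread. *)
lemma finite_partial_spread_cards:
  "finite {card S |S :: ('a::{field,finite} ^ 'n) set set. partial_spread t S}"
  by simp

lemma mu_attained:
  "\<exists>S :: ('a::{field,finite} ^ 'n) set set.
     partial_spread t S \<and> card S = mu TYPE('a) TYPE('n) t"
proof -
  let ?C = "{card S |S :: ('a ^ 'n) set set. partial_spread t S}"
  have "?C \<noteq> {}"
    using partial_spread_empty by blast
  then have "Max ?C \<in> ?C"
    by (intro Max_in finite_partial_spread_cards)
  then show ?thesis
    unfolding mu_def by force
qed

lemma card_le_mu: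
  fixes S :: "('a::{field,finite} ^ 'n) set set"
  assumes "partial_spread t S"
  shows "card S \<le> mu TYPE('a) TYPE('n) t"
  unfolding mu_def using assms by (intro Max_ge finite_partial_spread_cards) blast

end

theory Submission
  imports Defs
begin

text \<open>
  Let \<open>D = (q - 1)(t - 2) + c1 - c2\<close> and \<open>c = q\<^sup>r - D\<close>, and let \<open>S\<close> be a partial spread
  with exactly \<open>L + c + 1\<close> members, where \<open>L = (q\<^sup>n - q\<^bsup>t+r\<^esup>) / (q\<^sup>t - 1)\<close>. Count the nonzero
  vectors covered by no member of \<open>S\<close> (the holes). A subspace of codimension \<open>t - s\<close> contains
  \<open>c + B q\<^sup>s\<close> of them, for an integer \<open>B\<close> congruent to \<open>- c\<close> modulo \<open>q - 1\<close>, and the whole space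
  has \<open>B = q\<^sup>r - 1 - c\<close>. Averaging over hyperplane sections yields a section for which \<open>B\<close> is
  smaller; by the congruence, it drops by at least \<open>q - 1\<close>. Iterating, some subspace of codimension
  \<open>t - s\<close> has \<open>B \<le> q\<^sup>r - 1 - c - (q - 1)(t - s)\<close>. In that subspace the second moment of the
  number of holes in a hyperplane section, together with the gap \<open>q - 1\<close> between successive values
  of \<open>B\<close>, forces \<open>q\<^sup>s (c - B) \<le> c (c + 1)\<close>. This fails for \<open>s = 2\<close> if \<open>c < q\<^sup>2\<close>, and for
  \<open>s = k + 2\<close> if \<open>q\<^sup>k < c < q\<^bsup>k+1\<^esup>\<close> with \<open>k \<ge> 2\<close>. The correction terms \<open>c1\<close> and \<open>c2\<close> serve to
  make \<open>c\<close> divisible by \<open>q\<close> but not by \<open>q\<^sup>2\<close>.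
\<close>

section \<open>Linear functionals and cardinalities of subspaces\<close>

lemma card_field_ge_2: "2 \<le> CARD('a::{field,finite})"
  using card_mono[of UNIV "{0, 1 :: 'a}"] by simp

text \<open>Every linear functional is \<open>dot a\<close> for exactly one \<open>a\<close>, so
  summing over all \<open>a\<close> visits each hyperplane through 0 exactly q - 1 times, and the
  whole space once, at \<open>a = 0\<close>.\<close>

definition dot :: "'a::field ^ 'n \<Rightarrow> 'a ^ 'n \<Rightarrow> 'a" where
  "dot a x = (\<Sum>i\<in>UNIV. a $ i * x $ i)"

lemma dot_commute: "dot a x = dot x a"
  by (simp add: dot_def mult.commute)

lemma dot_add: "dot a (x + y) = dot a x + dot a y"
  by (simp add: dot_def distrib_left sum.distrib)

lemma dot_scale: "dot a (k *s x) = k * dot a x"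
  by (simp add: dot_def sum_distrib_left mult.left_commute)

lemma dot_zero: "dot a 0 = 0"
  by (simp add: dot_def)

lemma dot_axis: "dot a (axis i k) = a $ i * k"
  by (simp add: dot_def axis_def if_distrib cong: if_cong)

lemma subspace_dot: "vec.subspace {x. dot a x = 0}"
  by (auto simp: vec.subspace_def dot_add dot_scale dot_zero)

text \<open>Each vector of \<open>W\<close> splits uniquely into an element of the kernel and a
  multiple of \<open>x0\<close>.\<close>

lemma card_subspace_inter_hyperplane:
  fixes W :: "('a::{field,finite} ^ 'n) set"
  assumes W: "vec.subspace W" and x0: "x0 \<in> W" "dot a x0 \<noteq> 0"
  shows "card W = CARD('a) * card (W \<inter> {x. dot a x = 0})"
proof -
  let ?K = "W \<inter> {x. dot a x = 0}"
  have "bij_betw (\<lambda>(k, x). x + k *s x0) (UNIV \<times> ?K) W"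
  proof (rule bij_betw_byWitness[where f' = "\<lambda>y. (dot a y / dot a x0, y - (dot a y / dot a x0) *s x0)"])
    show "\<forall>p\<in>UNIV \<times> ?K. (\<lambda>y. (dot a y / dot a x0, y - (dot a y / dot a x0) *s x0))
             ((\<lambda>(k, x). x + k *s x0) p) = p"
      using x0 by (auto simp: dot_add dot_scale)
    show "\<forall>y\<in>W. (\<lambda>(k, x). x + k *s x0) (dot a y / dot a x0, y - (dot a y / dot a x0) *s x0) = y"
      by auto
    show "(\<lambda>(k, x). x + k *s x0) ` (UNIV \<times> ?K) \<subseteq> W"
      using W x0 by (auto intro!: vec.subspace_add vec.subspace_scale)
    have "dot a (y - (dot a y / dot a x0) *s x0) = 0" for y
    proof -
      have "dot a y = dot a ((y - (dot a y / dot a x0) *s x0) + (dot a y / dot a x0) *s x0)"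
        by simp
      then show ?thesis
        using x0 by (simp only: dot_add dot_scale) simp
    qed
    then show "(\<lambda>y. (dot a y / dot a x0, y - (dot a y / dot a x0) *s x0)) ` W \<subseteq> UNIV \<times> ?K"
      using W x0 by (auto intro!: vec.subspace_diff vec.subspace_scale)
  qed
  then have "card (UNIV \<times> ?K :: ('a \<times> _) set) = card W"
    by (rule bij_betw_same_card)
  then show ?thesis
    by (simp add: card_cartesian_product)
qed

lemma card_le_inter_hyperplane:
  fixes W :: "('a::{field,finite} ^ 'n) set"
  assumes W: "vec.subspace W"
  shows "card W \<le> CARD('a) * card (W \<inter> {x. dot a x = 0})"
proof (cases "\<exists>x\<in>W. dot a x \<noteq> 0")
  case True
  then show ?thesis
    using card_subspace_inter_hyperplane[OF W] by fastforce
next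
  case False
  then have "W \<inter> {x. dot a x = 0} = W" by auto
  then show ?thesis by simp
qed

lemma card_span_independent:
  fixes B :: "('a::{field,finite} ^ 'n) set"
  assumes "vec.independent B"
  shows "card (vec.span B) = CARD('a) ^ card B"
proof -
  have "finite B" by simp
  then show ?thesis using assms
  proof (induction B)
    case empty
    then show ?case by simp
  next
    case (insert b B)
    have b: "b \<notin> vec.span B" and B: "vec.independent B"
      using insert.prems insert.hyps by (auto simp: vec.independent_insert)
    have "bij_betw (\<lambda>(k, x). x + k *s b) (UNIV \<times> vec.span B) (vec.span (insert b B))"
      unfolding bij_betw_def
    proof
      show "inj_on (\<lambda>(k, x). x + k *s b) (UNIV \<times> vec.span B)"
      proof (rule inj_onI, clarify)
        fix k l x y
        assume x: "x \<in> vec.span B" and y: "y \<in> vec.span B" and eq: "x + k *s b = y + l *s b"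
        have "(k - l) *s b = y - x"
          using eq by (simp add: vec.scale_left_diff_distrib algebra_simps)
        then have "(k - l) *s b \<in> vec.span B"
          using x y by (simp add: vec.span_diff)
        then have "inverse (k - l) *s ((k - l) *s b) \<in> vec.span B"
          by (rule vec.span_scale)
        moreover have "inverse (k - l) *s ((k - l) *s b) = b" if "k \<noteq> l"
          unfolding vec.scale_scale using that by (subst left_inverse) auto
        ultimately have "k = l"
          using b by metis
        then show "k = l \<and> x = y" using eq by simp
      qed
      show "(\<lambda>(k, x). x + k *s b) ` (UNIV \<times> vec.span B) = vec.span (insert b B)"
      proof (intro equalityI subsetI)
        fix y assume "y \<in> (\<lambda>(k, x). x + k *s b) ` (UNIV \<times> vec.span B)"
        then obtain k x where "x \<in> vec.span B" "y = x + k *s b" by auto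
        then have "y - k *s b \<in> vec.span B" by simp
        then show "y \<in> vec.span (insert b B)" by (auto simp: vec.span_insert)
      next
        fix y assume "y \<in> vec.span (insert b B)"
        then obtain k where "y - k *s b \<in> vec.span B" by (auto simp: vec.span_insert)
        then show "y \<in> (\<lambda>(k, x). x + k *s b) ` (UNIV \<times> vec.span B)"
          by (intro image_eqI[of _ _ "(k, y - k *s b)"]) auto
      qed
    qed
    then have "card (UNIV \<times> vec.span B :: ('a \<times> _) set) = card (vec.span (insert b B))"
      by (rule bij_betw_same_card)
    then show ?case
      using insert.IH[OF B] insert.hyps by (simp add: card_cartesian_product)
  qed
qed

lemma card_subspace:
  fixes W :: "('a::{field,finite} ^ 'n) set"
  assumes "vec.subspace W"
  shows "card W = CARD('a) ^ vec.dim W"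
proof -
  obtain B where "B \<subseteq> W" "vec.independent B" "W \<subseteq> vec.span B" "card B = vec.dim W"
    using vec.basis_exists by blast
  moreover from this have "W = vec.span B"
    using assms by (meson equalityI vec.span_minimal)
  ultimately show ?thesis
    using card_span_independent by metis
qed

text \<open>By symmetry of \<open>dot\<close>, the functionals vanishing at \<open>x\<close>
  themselves form a hyperplane. The factor \<open>CARD('a)\<close> avoids the exponent n -
  1.\<close>

lemma card_hyperplane:
  fixes x :: "'a::{field,finite} ^ 'n"
  assumes "x \<noteq> 0"
  shows "CARD('a) * card {a. dot a x = 0} = CARD('a) ^ CARD('n)"
proof -
  obtain i where "x $ i \<noteq> 0" using assms by (auto simp: vec_eq_iff)
  then have "dot x (axis i 1) \<noteq> 0" by (simp add: dot_axis)
  from card_subspace_inter_hyperplane[OF vec.subspace_UNIV _ this]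
  show ?thesis by (simp add: dot_commute[of x])
qed

lemma card_inter_two_hyperplanes:
  fixes x y :: "'a::{field,finite} ^ 'n"
  assumes x: "x \<noteq> 0" and y: "\<And>k. y \<noteq> k *s x"
  shows "(CARD('a))\<^sup>2 * card {a. dot a x = 0 \<and> dot a y = 0} = CARD('a) ^ CARD('n)"
proof -
  obtain i where i: "x $ i \<noteq> 0" using x by (auto simp: vec_eq_iff)
  obtain j where j: "y $ j \<noteq> (y $ i / x $ i) * x $ j"
    using y[of "y $ i / x $ i"] by (auto simp: vec_eq_iff)
  \<comment> \<open>The choice makes \<open>dot x b\<close> vanish identically, while
    \<open>dot y b\<close> is a nonzero 2 by 2 minor of \<open>x\<close> and
    \<open>y\<close>.\<close>
  define b where "b = axis j (x $ i) + axis i (- x $ j)"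
  have "dot x b = 0" "dot y b \<noteq> 0"
    using i j by (auto simp: b_def dot_add dot_scale dot_axis field_simps)
  then have "card {a. dot x a = 0} = CARD('a) * card ({a. dot x a = 0} \<inter> {a. dot y a = 0})"
    using card_subspace_inter_hyperplane[OF subspace_dot, of b x y] by simp
  moreover have "{a. dot x a = 0} \<inter> {a. dot y a = 0} = {a. dot a x = 0 \<and> dot a y = 0}"
    by (auto simp: dot_commute)
  moreover have "{a. dot x a = 0} = {a. dot a x = 0}"
    by (auto simp: dot_commute)
  ultimately show ?thesis
    using card_hyperplane[OF x] by (simp add: power2_eq_square mult.assoc)
qed

section \<open>Moments of the size of a hyperplane section\<close>

lemma sum_card_swap:
  assumes "finite A" "finite T"
  shows "(\<Sum>a\<in>A. card {x\<in>T. P a x}) = (\<Sum>x\<in>T. card {a\<in>A. P a x})"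
proof -
  have "(\<Sum>a\<in>A. card {x\<in>T. P a x}) = (\<Sum>a\<in>A. \<Sum>x\<in>T. if P a x then 1 else 0)"
    using assms by (simp add: sum.If_cases Int_def)
  also have "\<dots> = (\<Sum>x\<in>T. \<Sum>a\<in>A. if P a x then 1 else 0)"
    by (rule sum.swap)
  also have "\<dots> = (\<Sum>x\<in>T. card {a\<in>A. P a x})"
    using assms by (simp add: sum.If_cases Int_def)
  finally show ?thesis .
qed

lemma sum_card_hyperplane_sections:
  fixes T :: "('a::{field,finite} ^ 'n) set"
  assumes "0 \<notin> T"
  shows "CARD('a) * (\<Sum>a\<in>UNIV. card {x\<in>T. dot a x = 0}) = CARD('a) ^ CARD('n) * card T"
proof -
  have "CARD('a) * (\<Sum>a\<in>UNIV. card {x\<in>T. dot a x = 0})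
      = (\<Sum>x\<in>T. CARD('a) * card {a. dot a x = 0})"
    by (simp add: sum_card_swap sum_distrib_left)
  also have "\<dots> = (\<Sum>x\<in>T. CARD('a) ^ CARD('n))"
    using assms by (intro sum.cong refl card_hyperplane) auto
  finally show ?thesis by simp
qed

text \<open>Squares count ordered pairs. An independent pair is killed by q^(n-2) functionals, a
  dependent pair by q^(n-1). Closure of \<open>T\<close> under scaling fixes the number of dependent
  pairs: q - 1 for each \<open>x\<close>.\<close>

lemma sum_card_hyperplane_sections_squared:
  fixes T :: "('a::{field,finite} ^ 'n) set"
  assumes 0: "0 \<notin> T" and scale: "\<And>k x. x \<in> T \<Longrightarrow> k \<noteq> 0 \<Longrightarrow> k *s x \<in> T"
  shows "int ((CARD('a))\<^sup>2) * (\<Sum>a\<in>UNIV. (int (card {x\<in>T. dot a x = 0}))\<^sup>2)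
       = int (CARD('a) ^ CARD('n)) * (int (card T) * (int (card T) + (int (CARD('a)) - 1)\<^sup>2))"
proof -
  let ?q = "CARD('a)" and ?N = "CARD('a) ^ CARD('n)"
  have sq: "(card {x\<in>T. dot a x = 0})\<^sup>2
      = card {p\<in>T \<times> T. dot a (fst p) = 0 \<and> dot a (snd p) = 0}" for a
  proof -
    have "{p\<in>T \<times> T. dot a (fst p) = 0 \<and> dot a (snd p) = 0}
        = {x\<in>T. dot a x = 0} \<times> {x\<in>T. dot a x = 0}" by auto
    then show ?thesis by (simp add: card_cartesian_product power2_eq_square)
  qed
  have inner: "(\<Sum>y\<in>T. int (?q\<^sup>2 * card {a. dot a x = 0 \<and> dot a y = 0}))
      = int ?N * (int (card T) + (int ?q - 1)\<^sup>2)" if x: "x \<in> T" for x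
  proof -
    have x0: "x \<noteq> 0" using x 0 by auto
    let ?M = "(\<lambda>k. k *s x) ` (UNIV - {0})"
    have inj: "inj_on (\<lambda>k. k *s x) (UNIV - {0})"
      using x0 by (auto simp: inj_on_def)
    have M: "?M \<subseteq> T" using x scale by auto
    have cM: "card ?M = ?q - 1"
      by (simp add: card_image[OF inj])
    have dep: "int (?q\<^sup>2 * card {a. dot a x = 0 \<and> dot a y = 0}) = int ?q * int ?N"
      if "y \<in> ?M" for y
    proof -
      have "{a. dot a x = 0 \<and> dot a y = 0} = {a. dot a x = 0}"
        using that by (auto simp: dot_scale)
      then have "?q\<^sup>2 * card {a. dot a x = 0 \<and> dot a y = 0} = ?q * (?q * card {a. dot a x = 0})"
        by (simp add: power2_eq_square)
      also have "\<dots> = ?q * ?N"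
        by (simp only: card_hyperplane[OF x0])
      finally show ?thesis by (simp only: of_nat_mult)
    qed
    have indep: "int (?q\<^sup>2 * card {a. dot a x = 0 \<and> dot a y = 0}) = int ?N"
      if "y \<in> T - ?M" for y
    proof -
      have y: "y \<noteq> k *s x" for k
        using that 0 by (cases "k = 0") auto
      show ?thesis using card_inter_two_hyperplanes[OF x0, of y, OF y] by (simp only:)
    qed
    have "(\<Sum>y\<in>T. int (?q\<^sup>2 * card {a. dot a x = 0 \<and> dot a y = 0}))
        = (\<Sum>y\<in>T - ?M. int (?q\<^sup>2 * card {a. dot a x = 0 \<and> dot a y = 0}))
        + (\<Sum>y\<in>?M. int (?q\<^sup>2 * card {a. dot a x = 0 \<and> dot a y = 0}))"
      by (intro sum.subset_diff M) simp
    also have "\<dots> = int (card (T - ?M)) * int ?N + int (card ?M) * (int ?q * int ?N)"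
      using dep indep by simp
    also have "\<dots> = int ?N * (int (card T) + (int ?q - 1)\<^sup>2)"
    proof -
      have "card ?M \<le> card T" by (intro card_mono M) simp
      moreover have "card (T - ?M) = card T - card ?M" by (intro card_Diff_subset M) simp
      moreover have "?q \<ge> 1" by (simp add: Suc_leI)
      ultimately have "int (card (T - ?M)) = int (card T) - (int ?q - 1)" "int (card ?M) = int ?q - 1"
        using cM by auto
      then show ?thesis by (simp only:) (simp add: power2_eq_square algebra_simps)
    qed
    finally show ?thesis .
  qed
  have "?q\<^sup>2 * (\<Sum>a\<in>UNIV. (card {x\<in>T. dot a x = 0})\<^sup>2)
      = ?q\<^sup>2 * (\<Sum>p\<in>T \<times> T. card {a. dot a (fst p) = 0 \<and> dot a (snd p) = 0})"
    by (simp only: sq) (simp add: sum_card_swap)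
  also have "\<dots> = (\<Sum>x\<in>T. \<Sum>y\<in>T. ?q\<^sup>2 * card {a. dot a x = 0 \<and> dot a y = 0})"
    by (simp add: sum_distrib_left sum.cartesian_product case_prod_beta)
  finally have "int (?q\<^sup>2 * (\<Sum>a\<in>UNIV. (card {x\<in>T. dot a x = 0})\<^sup>2))
      = int (\<Sum>x\<in>T. \<Sum>y\<in>T. ?q\<^sup>2 * card {a. dot a x = 0 \<and> dot a y = 0})" by simp
  also have "\<dots> = (\<Sum>x\<in>T. int ?N * (int (card T) + (int ?q - 1)\<^sup>2))"
    unfolding of_nat_sum by (intro sum.cong refl inner)
  finally show ?thesis by (simp add: algebra_simps)
qed

section \<open>Holes of a partial spread\<close>

definition holes :: "('a::field ^ 'n) set set \<Rightarrow> ('a ^ 'n) set \<Rightarrow> ('a ^ 'n) set" where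
  "holes S W = {x\<in>W. x \<noteq> 0 \<and> x \<notin> \<Union>S}"

lemma holes_inter_hyperplane: "holes S (W \<inter> {x. dot a x = 0}) = {x\<in>holes S W. dot a x = 0}"
  by (auto simp: holes_def)

text \<open>Nonzero scaling is invertible and preserves every member of \<open>S\<close>. This
  supplies the closure hypothesis of the second moment formula.\<close>

lemma scale_mem_holes:
  assumes S: "partial_spread t S" and W: "vec.subspace W" and x: "x \<in> holes S W" and k: "k \<noteq> 0"
  shows "k *s x \<in> holes S W"
proof -
  have "k *s x \<notin> U" if "U \<in> S" for U
  proof
    assume "k *s x \<in> U"
    moreover have "vec.subspace U" using S that by (simp add: partial_spread_def)
    ultimately have "inverse k *s (k *s x) \<in> U" by (metis vec.subspace_scale)
    then have "x \<in> U" using k by (simp add: vec.scale_scale)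
    then show False using x that by (auto simp: holes_def)
  qed
  then show ?thesis
    using x k W by (auto simp: holes_def vec.subspace_scale)
qed

text \<open>The nonzero vectors of \<open>W\<close> are the disjoint union of the holes and the
  punctured sections of \<open>W\<close> by the members of \<open>S\<close>.\<close>

lemma card_holes:
  fixes S :: "('a::{field,finite} ^ 'n) set set"
  assumes S: "partial_spread t S" and W: "vec.subspace W"
  shows "int (card (holes S W)) = int (card W) - 1 - (\<Sum>U\<in>S. int (card (W \<inter> U)) - 1)"
proof -
  have sub: "vec.subspace U" if "U \<in> S" for U
    using S that by (simp add: partial_spread_def)
  have minus1: "int (card (X - {0})) = int (card X) - 1" if "0 \<in> X" for X :: "('a ^ 'n) set"
  proof -
    have "card X > 0" using that by (auto simp: card_gt_0_iff)
    then show ?thesis using that by (simp add: card_Diff_singleton)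
  qed
  have "W - {0} = holes S W \<union> (\<Union>U\<in>S. W \<inter> U - {0})"
    by (auto simp: holes_def)
  moreover have "holes S W \<inter> (\<Union>U\<in>S. W \<inter> U - {0}) = {}"
    by (auto simp: holes_def)
  ultimately have "card (W - {0}) = card (holes S W) + card (\<Union>U\<in>S. W \<inter> U - {0})"
    by (simp add: card_Un_disjoint)
  also have "card (\<Union>U\<in>S. W \<inter> U - {0}) = (\<Sum>U\<in>S. card (W \<inter> U - {0}))"
    using S by (intro card_UN_disjoint) (auto simp: partial_spread_def pairwise_def)
  finally have "int (card (W - {0})) = int (card (holes S W)) + (\<Sum>U\<in>S. int (card (W \<inter> U - {0})))"
    by simp
  moreover have "(\<Sum>U\<in>S. int (card (W \<inter> U - {0}))) = (\<Sum>U\<in>S. int (card (W \<inter> U)) - 1)"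
    using W sub by (intro sum.cong refl minus1) (auto intro: vec.subspace_0)
  ultimately show ?thesis
    using minus1[of W] W by (simp add: vec.subspace_0)
qed

text \<open>
  The bounds are inherited by hyperplane sections (with \<open>s\<close> lowered by one), even by those that do not
  lower the dimension of \<open>W\<close>; so averages may run over all \<open>a\<close>, including \<open>a = 0\<close>.
\<close>

definition deep :: "nat \<Rightarrow> ('a::{field,finite} ^ 'n) set set \<Rightarrow> ('a ^ 'n) set \<Rightarrow> bool" where
  "deep s S W \<longleftrightarrow> vec.subspace W \<and> CARD('a) ^ s \<le> card W \<and> (\<forall>U\<in>S. CARD('a) ^ s \<le> card (W \<inter> U))"

text \<open>A hyperplane divides the size of a subspace by at most q; this applies to
  \<open>W\<close> and to each \<open>W \<inter> U\<close>.\<close>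

lemma deep_inter_hyperplane:
  fixes W :: "('a::{field,finite} ^ 'n) set"
  assumes S: "partial_spread t S" and W: "deep (Suc s) S W"
  shows "deep s S (W \<inter> {x. dot a x = 0})"
proof -
  have *: "CARD('a) ^ s \<le> card (X \<inter> {x. dot a x = 0})"
    if "vec.subspace X" "CARD('a) ^ Suc s \<le> card X" for X :: "('a ^ 'n) set"
  proof -
    have "CARD('a) * CARD('a) ^ s \<le> CARD('a) * card (X \<inter> {x. dot a x = 0})"
      using card_le_inter_hyperplane[OF that(1), of a] that(2) by (metis order_trans power_Suc)
    then show ?thesis by (rule mult_left_le_imp_le) (simp add: card_gt_0_iff)
  qed
  have "CARD('a) ^ s \<le> card (W \<inter> {x. dot a x = 0} \<inter> U)" if "U \<in> S" for U
  proof -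
    have "W \<inter> {x. dot a x = 0} \<inter> U = (W \<inter> U) \<inter> {x. dot a x = 0}" by auto
    then show ?thesis
      using *[of "W \<inter> U"] W S that by (simp add: deep_def partial_spread_def vec.subspace_inter)
  qed
  then show ?thesis
    using W *[of W] by (simp add: deep_def vec.subspace_inter subspace_dot)
qed

lemma power_dvd_card_subspace:
  fixes W :: "('a::{field,finite} ^ 'n) set"
  assumes "vec.subspace W" "CARD('a) ^ s \<le> card W"
  shows "int (CARD('a)) ^ s dvd int (card W)"
proof -
  have "s \<le> vec.dim W"
    using assms card_field_ge_2[where 'a='a] by (simp add: card_subspace)
  then show ?thesis
    using assms by (simp add: card_subspace le_imp_power_dvd)
qed

lemma dvd_card_subspace_minus_1:
  fixes W :: "('a::{field,finite} ^ 'n) set"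
  assumes "vec.subspace W"
  shows "int (CARD('a)) - 1 dvd int (card W) - 1"
  using assms by (simp add: card_subspace power_diff_1_eq)

text \<open>Modulo q^s the sizes of \<open>W\<close> and of its sections vanish, as does
  \<open>L\<close>, leaving \<open>c\<close>. Modulo q - 1 all these sizes are 1, so the hole count
  vanishes; as q^s is 1 too, so does \<open>c + B\<close>.\<close>

lemma card_holes_deep:
  fixes S :: "('a::{field,finite} ^ 'n) set set" and c L :: int
  assumes S: "partial_spread t S" and W: "deep s S W" and "s \<le> t"
    and L: "int (CARD('a)) ^ t dvd L" and card_S: "int (card S) = L + c + 1"
  obtains B where "int (card (holes S W)) = c + B * int (CARD('a)) ^ s" "int (CARD('a)) - 1 dvd c + B"
proof -
  let ?q = "int (CARD('a))"
  have sub: "vec.subspace W" "vec.subspace (W \<inter> U)" if "U \<in> S" for U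
    using S W that by (auto simp: partial_spread_def deep_def intro: vec.subspace_inter)
  have subW: "vec.subspace W" using W by (simp add: deep_def)
  have Z: "int (card (holes S W)) = int (card W) - (\<Sum>U\<in>S. int (card (W \<inter> U))) + L + c"
    using card_holes[OF S subW] card_S by (simp add: sum_subtractf)
  have "?q ^ s dvd (\<Sum>U\<in>S. int (card (W \<inter> U)))"
    using W sub by (intro dvd_sum power_dvd_card_subspace) (auto simp: deep_def)
  moreover have "?q ^ s dvd int (card W)"
    using W by (intro power_dvd_card_subspace) (auto simp: deep_def)
  moreover have "?q ^ s dvd L"
    using L \<open>s \<le> t\<close> by (meson dvd_trans le_imp_power_dvd)
  ultimately have "?q ^ s dvd int (card (holes S W)) - c"
    unfolding Z by (simp add: dvd_diff)
  then obtain B where B: "int (card (holes S W)) - c = ?q ^ s * B" by blast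
  have "?q - 1 dvd int (card (holes S W))"
    unfolding card_holes[OF S subW]
    using sub by (intro dvd_diff dvd_sum dvd_card_subspace_minus_1 subW)
  then have "?q - 1 dvd c + B * ?q ^ s" using B by (simp add: algebra_simps)
  moreover have "?q - 1 dvd B * (?q ^ s - 1)"
    by (simp add: power_diff_1_eq)
  ultimately have "?q - 1 dvd (c + B * ?q ^ s) - B * (?q ^ s - 1)"
    by (rule dvd_diff)
  then have "?q - 1 dvd c + B" by (simp add: algebra_simps)
  then show ?thesis using that[of B] B by (simp add: algebra_simps)
qed

section \<open>Descent through hyperplane sections\<close>

text \<open>
  Writing \<open>c + B' q\<^sup>s\<close> for the number of holes in a section, the difference \<open>B' - B\<close> is a multiple of
  \<open>q - 1\<close> and has negative average; the second claim is that the average of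
  \<open>(B' - B) (B' - B + q - 1)\<close> is nonnegative.
\<close>

lemma hyperplane_section_moments:
  fixes S :: "('a::{field,finite} ^ 'n) set set" and c L B :: int
  assumes S: "partial_spread t S" and W: "deep (Suc s) S W" and "Suc s \<le> t"
    and L: "int (CARD('a)) ^ t dvd L" and card_S: "int (card S) = L + c + 1"
    and Z: "int (card (holes S W)) = c + B * int (CARD('a)) ^ Suc s"
    and B: "int (CARD('a)) - 1 dvd c + B"
    and "0 < c"
  shows "\<exists>a B'. int (card (holes S (W \<inter> {x. dot a x = 0}))) = c + B' * int (CARD('a)) ^ s \<and>
            int (CARD('a)) - 1 dvd c + B' \<and> B' \<le> B - (int (CARD('a)) - 1)" (is ?descent)
    and "0 \<le> c * (c + 1) + B * int (CARD('a)) ^ Suc s - c * int (CARD('a)) ^ Suc s" (is ?variance)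
proof -
  define q where "q = int (CARD('a))"
  define N where "N = q ^ CARD('n)"
  define D where "D = q ^ s"
  define h where "h = (\<lambda>a. int (card {x\<in>holes S W. dot a x = 0}))"
  have q: "q \<ge> 2" using card_field_ge_2[where 'a='a] by (simp add: q_def)
  have N: "N > 0" and D: "D > 0" using q by (auto simp: N_def D_def)
  have subW: "vec.subspace W" using W by (simp add: deep_def)
  have "\<exists>y. h a = c + y * D \<and> q - 1 dvd c + y" for a
    using card_holes_deep[OF S deep_inter_hyperplane[OF S W, of a] _ L card_S] \<open>Suc s \<le> t\<close>
    unfolding h_def q_def D_def holes_inter_hyperplane
    by (metis Suc_leD)
  then obtain y where y: "\<And>a. h a = c + y a * D" and dvd_y: "\<And>a. q - 1 dvd c + y a"
    by metis
  have dvd: "q - 1 dvd y a - B" for a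
    using dvd_diff[OF dvd_y[of a] B[folded q_def]] by simp
  have Z': "int (card (holes S W)) = c + B * (q * D)"
    using Z by (simp add: q_def D_def)
  have sum_const: "(\<Sum>a\<in>(UNIV :: ('a ^ 'n) set). k) = N * k" for k :: int
    by (simp add: N_def q_def CARD_vec)
  have "CARD('a) * (\<Sum>a\<in>UNIV. card {x\<in>holes S W. dot a x = 0}) = CARD('a) ^ CARD('n) * card (holes S W)"
    by (intro sum_card_hyperplane_sections) (simp add: holes_def)
  from arg_cong[OF this, of int] have m1: "q * (\<Sum>a\<in>UNIV. h a) = N * (c + B * (q * D))"
    by (simp add: h_def q_def N_def flip: Z'[unfolded q_def])
  have m2: "q\<^sup>2 * (\<Sum>a\<in>UNIV. (h a)\<^sup>2) = N * ((c + B * (q * D)) * (c + B * (q * D) + (q - 1)\<^sup>2))"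
    using sum_card_hyperplane_sections_squared[of "holes S W"] scale_mem_holes[OF S subW]
    by (simp add: h_def q_def N_def holes_def flip: Z'[unfolded q_def holes_def])
  \<comment> \<open>Deviation from the count that would keep \<open>B\<close> unchanged. The mean of
    \<open>h\<close> is c/q + B D, so the mean deviation is negative because
    \<open>c > 0\<close>.\<close>
  let ?X = "\<lambda>a. h a - (c + B * D)"
  have X: "?X a = (y a - B) * D" for a by (simp add: y algebra_simps)
  have "q * (\<Sum>a\<in>UNIV. ?X a) = N * (c + B * (q * D)) - q * (N * (c + B * D))"
    by (simp only: sum_subtractf sum_const right_diff_distrib m1)
  also have "\<dots> = - (N * c * (q - 1))" by (simp add: algebra_simps)
  also have "\<dots> < 0" using N q \<open>0 < c\<close> by simp
  finally have "(\<Sum>a\<in>UNIV. ?X a) < 0" using q by (simp add: mult_less_0_iff)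
  then obtain a where "?X a < 0"
    by (meson not_le sum_nonneg)
  then have "y a < B" using D by (simp add: X mult_less_0_iff)
  then have "q - 1 \<le> B - y a"
    using dvd[of a] by (intro zdvd_imp_le) (auto simp: dvd_diff_commute)
  then show ?descent
    unfolding holes_inter_hyperplane using y[of a] dvd_y[of a]
    by (intro exI[of _ a] exI[of _ "y a"]) (auto simp: h_def q_def D_def)
  have nonneg: "0 \<le> ?X a * (?X a + (q - 1) * D)" for a
  proof -
    obtain z where z: "y a - B = (q - 1) * z" using dvd[of a] by blast
    \<comment> \<open>Integrality of \<open>z\<close> is essential here: the product is negative for
      real \<open>z\<close> strictly between -1 and 0.\<close>
    have "0 \<le> z * (z + 1)" by (cases "z \<ge> 0") (auto simp: mult_nonpos_nonpos)
    then have "0 \<le> ((q - 1) * D)\<^sup>2 * (z * (z + 1))" by simp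
    also have "\<dots> = ?X a * (?X a + (q - 1) * D)"
      by (simp only: X z) (simp add: power2_eq_square algebra_simps)
    finally show ?thesis .
  qed
  have "0 \<le> q\<^sup>2 * (\<Sum>a\<in>UNIV. ?X a * (?X a + (q - 1) * D))"
    by (intro mult_nonneg_nonneg sum_nonneg nonneg) auto
  also have "(\<Sum>a\<in>UNIV. ?X a * (?X a + (q - 1) * D))
      = (\<Sum>a\<in>UNIV. (h a)\<^sup>2 + (((q - 1) * D - 2 * (c + B * D)) * h a + (c + B * D) * (c + B * D - (q - 1) * D)))"
    by (intro sum.cong refl) (simp add: power2_eq_square algebra_simps)
  also have "q\<^sup>2 * \<dots> = q\<^sup>2 * (\<Sum>a\<in>UNIV. (h a)\<^sup>2)
      + (q * ((q - 1) * D - 2 * (c + B * D)) * (q * (\<Sum>a\<in>UNIV. h a))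
      + q\<^sup>2 * (N * ((c + B * D) * (c + B * D - (q - 1) * D))))"
    by (simp only: sum.distrib sum_const sum_distrib_left[symmetric])
       (simp add: power2_eq_square algebra_simps)
  \<comment> \<open>Completing the square leaves (c + B q D) - q (c + B D) = - (q - 1) c, which is
    why (q - 1)^2 factors out.\<close>
  also have "\<dots> = N * (q - 1)\<^sup>2 * (c * (c + 1) + B * (q * D) - c * (q * D))"
    unfolding m1 m2 by (simp add: power2_eq_square algebra_simps)
  finally have "0 \<le> (N * (q - 1)\<^sup>2) * (c * (c + 1) + B * (q * D) - c * (q * D))" .
  moreover have "0 < N * (q - 1)\<^sup>2" using N q by simp
  ultimately have "0 \<le> c * (c + 1) + B * (q * D) - c * (q * D)"
    by (simp only: zero_le_mult_iff) linarith
  then show ?variance by (simp add: q_def D_def)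
qed

text \<open>Induction on the number \<open>j\<close> of hyperplane cuts, starting from the whole
  space, where \<open>B\<close> is known exactly; each cut lowers \<open>B\<close> by at least q -
  1.\<close>

lemma exists_deep_subspace:
  fixes S :: "('a::{field,finite} ^ 'n) set set" and c L :: int
  assumes S: "partial_spread t S" and "t \<le> CARD('n)"
    and L: "int (CARD('a)) ^ t dvd L"
    and L_eq: "L * (int (CARD('a)) ^ t - 1) = int (CARD('a)) ^ CARD('n) - int (CARD('a)) ^ (t + r)"
    and card_S: "int (card S) = L + c + 1" and "0 < c" and "j \<le> t"
  shows "\<exists>W B. deep (t - j) S W \<and> int (card (holes S W)) = c + B * int (CARD('a)) ^ (t - j) \<and>
            int (CARD('a)) - 1 dvd c + B \<and>
            B \<le> int (CARD('a)) ^ r - 1 - c - (int (CARD('a)) - 1) * int j"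
  using \<open>j \<le> t\<close>
proof (induction j)
  case 0
  let ?q = "int (CARD('a))"
  have q: "?q \<ge> 2" using card_field_ge_2[where 'a='a] by simp
  have card_U: "card U = CARD('a) ^ t" if "U \<in> S" for U
    using S that by (simp add: partial_spread_def card_subspace)
  then have "deep t S UNIV"
    using \<open>t \<le> CARD('n)\<close> q by (simp add: deep_def CARD_vec power_increasing)
  moreover from card_holes_deep[OF S this _ L card_S]
  obtain B where B: "int (card (holes S UNIV)) = c + B * ?q ^ t" "?q - 1 dvd c + B" by auto
  moreover have "B = ?q ^ r - 1 - c"
  proof -
  have "int (card (holes S UNIV)) = ?q ^ CARD('n) - 1 - int (card S) * (?q ^ t - 1)"
    using card_holes[OF S vec.subspace_UNIV] card_U by (simp add: CARD_vec)
  also have "\<dots> = c + (?q ^ r - 1 - c) * ?q ^ t"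
    using L_eq by (simp add: card_S algebra_simps power_add)
  finally show ?thesis using B q by simp
  qed
  ultimately show ?case using B by auto
next
  case (Suc j)
  let ?q = "int (CARD('a))"
  obtain W B where W: "deep (t - j) S W" and Z: "int (card (holes S W)) = c + B * ?q ^ (t - j)"
    and B: "?q - 1 dvd c + B" "B \<le> ?q ^ r - 1 - c - (?q - 1) * int j"
    using Suc by auto
  have tj: "t - j = Suc (t - Suc j)" using Suc.prems by simp
  have "Suc (t - Suc j) \<le> t" using Suc.prems by simp
  then obtain a B' where "int (card (holes S (W \<inter> {x. dot a x = 0}))) = c + B' * ?q ^ (t - Suc j)"
      "?q - 1 dvd c + B'" "B' \<le> B - (?q - 1)"
    using hyperplane_section_moments(1)[OF S W[unfolded tj] _ L card_S Z[unfolded tj] B(1) \<open>0 < c\<close>]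
    by blast
  moreover have "deep (t - Suc j) S (W \<inter> {x. dot a x = 0})"
    using W by (intro deep_inter_hyperplane[OF S]) (simp add: tj)
  ultimately show ?case using B(2) by (intro exI conjI) (auto simp: algebra_simps)
qed

text \<open>The variance claim is applied to the subspace reached after t - s cuts, with
  \<open>B\<close> replaced by its upper bound. It looks one cut further, hence
  \<open>1 \<le> s\<close>.\<close>

lemma partial_spread_inequality:
  fixes S :: "('a::{field,finite} ^ 'n) set set" and c L :: int
  assumes S: "partial_spread t S" and "t \<le> CARD('n)"
    and L: "int (CARD('a)) ^ t dvd L"
    and L_eq: "L * (int (CARD('a)) ^ t - 1) = int (CARD('a)) ^ CARD('n) - int (CARD('a)) ^ (t + r)"
    and card_S: "int (card S) = L + c + 1" and "0 < c" and "1 \<le> s" and "s \<le> t"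
  shows "int (CARD('a)) ^ s * (2 * c + 1 - int (CARD('a)) ^ r + (int (CARD('a)) - 1) * (int t - int s))
           \<le> c * (c + 1)"
proof -
  let ?q = "int (CARD('a))"
  have "t - s \<le> t" by simp
  from exists_deep_subspace[OF S \<open>t \<le> CARD('n)\<close> L L_eq card_S \<open>0 < c\<close> this]
  obtain W B where W: "deep s S W" and Z: "int (card (holes S W)) = c + B * ?q ^ s"
    and B: "?q - 1 dvd c + B" "B \<le> ?q ^ r - 1 - c - (?q - 1) * (int t - int s)"
    using \<open>s \<le> t\<close> by (auto simp: of_nat_diff)
  have s: "s = Suc (s - 1)" using \<open>1 \<le> s\<close> by simp
  have "0 \<le> c * (c + 1) + B * ?q ^ s - c * ?q ^ s"
    using hyperplane_section_moments(2)[OF S _ _ L card_S _ B(1) \<open>0 < c\<close>, of "s - 1" W, folded s] W Z \<open>s \<le> t\<close>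
    by simp
  moreover have "B * ?q ^ s \<le> (?q ^ r - 1 - c - (?q - 1) * (int t - int s)) * ?q ^ s"
    using B(2) by (intro mult_right_mono) auto
  ultimately show ?thesis by (simp add: algebra_simps)
qed

section \<open>Arithmetic: a level at which the inequality fails\<close>

text \<open>With \<open>e = c1 - c2\<close> and \<open>c\<close> as in the main proof, this
  contradicts \<open>partial_spread_inequality\<close> at level \<open>s\<close>.\<close>

lemma exists_level_violating_inequality:
  fixes q c e :: int and r t :: nat
  assumes q: "2 \<le> q" and c: "0 < c" "c < q ^ r" and "r < t" "2 \<le> t"
    and "q dvd c" and ndvd: "\<not> q\<^sup>2 dvd c" and e: "e \<le> q - 1"
  shows "\<exists>s\<ge>1. s \<le> t \<and> c * (c + 1) < q ^ s * (c + 1 - e - (q - 1) * (int s - 2))"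
proof (cases "c < q\<^sup>2")
  case True
  obtain u where u: "c = q * u" using \<open>q dvd c\<close> by blast
  have "1 \<le> u" using c(1) q by (simp add: u zero_less_mult_iff)
  moreover have "u \<le> q - 1" using True q by (simp add: u power2_eq_square)
  \<comment> \<open>The product equals u (q - u) - (q - 1): a concave quadratic is smallest at the
    endpoints of its range.\<close>
  ultimately have "0 \<le> (u - 1) * (q - 1 - u)" by simp
  then have "q * (q - 1) \<le> q * (u * (q - u))"
    using q by (intro mult_left_mono) (auto simp: algebra_simps)
  then have "u * (q * u + 1) < q * (q * u + 1 - (q - 1))"
    using \<open>u \<le> q - 1\<close> q by (simp add: algebra_simps)
  also have "\<dots> \<le> q * (q * u + 1 - e)"
    using e q by (intro mult_left_mono) auto
  finally have "q * (u * (q * u + 1)) < q * (q * (q * u + 1 - e))"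
    using q by simp
  then have "c * (c + 1) < q\<^sup>2 * (c + 1 - e)"
    by (simp add: u power2_eq_square mult.assoc)
  then show ?thesis
    using \<open>2 \<le> t\<close> by (intro exI[of _ 2]) auto
next
  case False
  \<comment> \<open>This is the integer part of log_q c, so that q^k \<le> c < q^(k+1).\<close>
  define k where "k = (LEAST m. c < q ^ Suc m)"
  have "c < q ^ Suc r" using c q by (smt (verit) power_Suc mult_le_cancel_right1 zero_less_power)
  then have ck: "c < q ^ Suc k" unfolding k_def by (rule LeastI)
  have "q ^ Suc k > q ^ 2" using False ck by linarith
  then have "k \<ge> 2" using q by (simp add: power_strict_increasing_iff del: power_Suc)
  have kc: "q ^ k \<le> c"
    using not_less_Least[of "k - 1" "\<lambda>m. c < q ^ Suc m", folded k_def] \<open>k \<ge> 2\<close> by (simp flip: power_Suc)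
  then have "q ^ k < q ^ r" using c by linarith
  then have "k < r" using q by simp
  have "q\<^sup>2 dvd q ^ k" using \<open>k \<ge> 2\<close> by (rule le_imp_power_dvd)
  then have "q ^ k \<noteq> c" using ndvd by auto
  moreover have "q dvd c - q ^ k" using \<open>q dvd c\<close> \<open>k \<ge> 2\<close> by (intro dvd_diff) auto
  \<comment> \<open>Since \<open>c\<close> differs from q^k and both are multiples of q, the gap is
    at least q; this pays for the term linear in \<open>k\<close>.\<close>
  ultimately have qc: "q \<le> c - q ^ k" using kc by (intro zdvd_imp_le) auto
  have "int k \<le> q ^ (k - 1)"
  proof -
    have "k - 1 < 2 ^ (k - 1)" by simp
    then have "int (k - 1) < 2 ^ (k - 1)" by (metis of_nat_less_iff of_nat_power of_nat_numeral)
    also have "\<dots> \<le> q ^ (k - 1)" using q by (intro power_mono) auto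
    finally show ?thesis using \<open>k \<ge> 2\<close> by simp
  qed
  then have "q * int k \<le> q * q ^ (k - 1)" using q by simp
  also have "q * q ^ (k - 1) = q ^ k" using \<open>k \<ge> 2\<close> by (simp flip: power_Suc)
  finally have lin: "q * (int k + 1) < q ^ k + q + 1" by (simp add: algebra_simps)
  define P where "P = q ^ k"
  have P: "P > 0" using q by (simp add: P_def)
  have "q\<^sup>2 * P * (e + (q - 1) * int k) \<le> q\<^sup>2 * P * ((q - 1) * (int k + 1))"
    using e P by (intro mult_left_mono) (auto simp: algebra_simps)
  also have "\<dots> = (q * (q - 1) * P) * (q * (int k + 1))"
    by (simp add: power2_eq_square)
  also have "\<dots> < (q * (q - 1) * P) * (P + q + 1)"
    using lin P q unfolding P_def by (intro mult_strict_left_mono) auto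
  also have "\<dots> = (P + q + 1) * (q\<^sup>2 * P - q * P)"
    by (simp add: power2_eq_square algebra_simps)
  \<comment> \<open>Both factors are compared separately: the gap above q^k bounds the first, and c
    < q P the second.\<close>
  also have "\<dots> \<le> (c + 1) * (q\<^sup>2 * P - c)"
  proof (rule mult_mono)
    show "P + q + 1 \<le> c + 1" using qc by (simp add: P_def)
    show "q\<^sup>2 * P - q * P \<le> q\<^sup>2 * P - c" using ck by (simp add: P_def)
    show "0 \<le> c + 1" using c by simp
    show "0 \<le> q\<^sup>2 * P - q * P" using P q by (simp add: power2_eq_square)
  qed
  finally have "c * (c + 1) < q\<^sup>2 * P * (c + 1 - e - (q - 1) * int k)"
    by (simp add: algebra_simps)
  then have "c * (c + 1) < q ^ (k + 2) * (c + 1 - e - (q - 1) * (int (k + 2) - 2))"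
    by (simp add: P_def power2_eq_square mult_ac)
  then show ?thesis
    using \<open>k < r\<close> \<open>r < t\<close> by (intro exI[of _ "k + 2"]) auto
qed

section \<open>The upper bound for partial spreads\<close>

theorem theorem6:
  fixes q n t r :: nat and c1 c2 :: int
  assumes "primepow q"
    and "q = CARD('a::{field,finite})"
    and "n = CARD('n::finite)"
    and "n > t" and "t > r" and "r \<ge> 0"
    and "[r = n] (mod t)"
    and "[c1 = int t - 2] (mod int q)" and "0 \<le> c1" and "c1 < int q"
    and "c2 = (if (int q)\<^sup>2 dvd ((int q - 1) * (int t - 2) + c1) then int q else 0)"
    and "2 \<le> r" and "r < t" and "real t \<le> Theta q r"
  shows "real (mu TYPE('a) TYPE('n) t)
           \<le> (real q ^ n - real q ^ (t + r)) / (real q ^ t - 1) + real q ^ r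
             - (real q - 1) * (real t - 2) - real_of_int c1 + real_of_int c2
       \<and> real (mu TYPE('a) TYPE('n) t)
           \<le> (real q ^ n - real q ^ (t + r)) / (real q ^ t - 1) + real q ^ r
             - (real q - 1) * (real t - 3) + 1"
proof -
  define Q where "Q = int q"
  define D where "D = (Q - 1) * (int t - 2) + c1"
  define c where "c = Q ^ r - D + c2"
  have q: "q \<ge> 2" using card_field_ge_2[where 'a='a] assms by simp
  then have Q: "Q \<ge> 2" by (simp add: Q_def)

  obtain k where "n = k * t + r"
  proof -
    have "r = n mod t" using \<open>[r = n] (mod t)\<close> \<open>r < t\<close> by (simp add: cong_def)
    then show ?thesis using that[of "n div t"] by simp
  qed
  moreover from this have "k \<noteq> 0" using \<open>n > t\<close> \<open>r < t\<close> by (cases k) auto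
  ultimately obtain m where m: "n = m * t + (t + r)" by (cases k) auto
  \<comment> \<open>The quotient in the bound is an integer, being a geometric sum: n - (t + r) is a
    multiple of t.\<close>
  define L where "L = Q ^ (t + r) * (\<Sum>i<m. (Q ^ t) ^ i)"
  have "L * (Q ^ t - 1) = Q ^ (t + r) * ((Q ^ t) ^ m - 1)"
    by (simp add: L_def power_diff_1_eq)
  also have "\<dots> = Q ^ n - Q ^ (t + r)"
    by (simp add: m power_add algebra_simps flip: power_mult)
  finally have L_eq: "L * (Q ^ t - 1) = Q ^ n - Q ^ (t + r)" .
  have L_dvd: "Q ^ t dvd L" by (simp add: L_def power_add)
  have "L \<ge> 0" using Q by (simp add: L_def sum_nonneg)
  have L_real: "(real q ^ n - real q ^ (t + r)) / (real q ^ t - 1) = real_of_int L"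
  proof -
    have "real_of_int (L * (Q ^ t - 1)) = real_of_int (Q ^ n - Q ^ (t + r))"
      by (simp only: L_eq)
    moreover have "real q ^ t > 1" using q \<open>r < t\<close> by (intro one_less_power) auto
    ultimately show ?thesis by (simp add: Q_def field_simps)
  qed

  have "Q dvd Q * (int t - 2) + (c1 - (int t - 2))"
    using \<open>[c1 = int t - 2] (mod int q)\<close> by (simp add: Q_def cong_iff_dvd_diff)
  then have "Q dvd D" by (simp add: D_def algebra_simps)
  have "Q\<^sup>2 dvd Q ^ r" using \<open>2 \<le> r\<close> by (rule le_imp_power_dvd)
  have c2: "c2 = (if Q\<^sup>2 dvd D then Q else 0)" using assms by (simp add: D_def Q_def)
  have "Q dvd c"
    using \<open>Q dvd D\<close> \<open>2 \<le> r\<close> by (auto simp: c_def c2)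
  \<comment> \<open>As r \<ge> 2, \<open>c\<close> is \<open>c2 - D\<close> modulo Q^2, and
    \<open>c2\<close> shifts by Q precisely when Q^2 divides \<open>D\<close>.\<close>
  have "\<not> Q\<^sup>2 dvd c"
  proof
    assume *: "Q\<^sup>2 dvd c"
    then have "Q\<^sup>2 dvd Q ^ r - c" using \<open>Q\<^sup>2 dvd Q ^ r\<close> by (rule dvd_diff[rotated])
    then have **: "Q\<^sup>2 dvd D - c2" by (simp add: c_def algebra_simps)
    show False
    proof (cases "Q\<^sup>2 dvd D")
      case True
      then have "Q\<^sup>2 dvd D - (D - c2)" using ** by (rule dvd_diff)
      then have "Q\<^sup>2 dvd Q" using True c2 by simp
      then have "Q\<^sup>2 \<le> Q" using Q by (intro zdvd_imp_le) auto
      then show False using Q by (simp add: power2_eq_square)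
    qed (use ** c2 in simp)
  qed
  have "D > 0" using Q assms by (simp add: D_def add_pos_nonneg)
  have "c < Q ^ r"
  proof (cases "Q\<^sup>2 dvd D")
    case True
    then have "Q\<^sup>2 \<le> D" using \<open>D > 0\<close> by (rule zdvd_imp_le)
    moreover have "Q < Q\<^sup>2" using Q by (simp add: power2_eq_square)
    ultimately show ?thesis using c2 True by (simp add: c_def)
  qed (use \<open>D > 0\<close> c2 in \<open>simp add: c_def\<close>)
  have "(Q - 1) * int t \<le> Q ^ r - 1"
  proof -
    have "real t * (real q - 1) \<le> real q ^ r - 1"
      using \<open>real t \<le> Theta q r\<close> q by (simp add: Theta_def field_simps)
    then have "real_of_int ((Q - 1) * int t) \<le> real_of_int (Q ^ r - 1)"
      by (simp add: Q_def algebra_simps)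
    then show ?thesis by (simp only: of_int_le_iff)
  qed
  moreover have "c2 \<ge> 0" using c2 Q by simp
  \<comment> \<open>The hypothesis on Theta gives c \<ge> 1 + 2 (Q - 1) - c1 + c2, and c1 \<le> Q -
    1.\<close>
  ultimately have "c > 0"
    using Q \<open>c1 < int q\<close> by (simp add: c_def D_def Q_def algebra_simps)

  obtain S :: "('a ^ 'n) set set" where S: "partial_spread t S" "card S = mu TYPE('a) TYPE('n) t"
    using mu_attained by blast
  have bound: "int (mu TYPE('a) TYPE('n) t) \<le> L + c"
  proof (rule ccontr)
    assume "\<not> ?thesis"
    then have "nat (L + c + 1) \<le> card S" using S by simp
    \<comment> \<open>The counting needs exactly L + c + 1 members; subsets of partial spreads are
      partial spreads.\<close>
    then obtain T where T: "T \<subseteq> S" "card T = nat (L + c + 1)"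
      by (meson obtain_subset_with_card_n)
    then have card_T: "int (card T) = L + c + 1" using \<open>L \<ge> 0\<close> \<open>c > 0\<close> by simp
    have spread: "partial_spread t T"
      using S T by (auto simp: partial_spread_def intro: pairwise_subset)
    have "c1 - c2 \<le> Q - 1" using \<open>c1 < int q\<close> \<open>c2 \<ge> 0\<close> by (simp add: Q_def)
    from exists_level_violating_inequality[OF Q \<open>c > 0\<close> \<open>c < Q ^ r\<close> \<open>r < t\<close> _ \<open>Q dvd c\<close> \<open>\<not> Q\<^sup>2 dvd c\<close> this]
    obtain s where s: "1 \<le> s" "s \<le> t"
      "c * (c + 1) < Q ^ s * (c + 1 - (c1 - c2) - (Q - 1) * (int s - 2))"
      using assms by auto
    have "Q ^ s * (2 * c + 1 - Q ^ r + (Q - 1) * (int t - int s)) \<le> c * (c + 1)"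
      using partial_spread_inequality[OF spread, of L r c s] L_dvd L_eq card_T \<open>c > 0\<close> s assms
      by (simp add: Q_def)
    also have "2 * c + 1 - Q ^ r + (Q - 1) * (int t - int s)
        = c + 1 - (c1 - c2) - (Q - 1) * (int s - 2)"
      by (simp add: c_def D_def algebra_simps)
    finally show False using s(3) by linarith
  qed
  then have "real_of_int (int (mu TYPE('a) TYPE('n) t)) \<le> real_of_int (L + c)"
    by (simp only: of_int_le_iff)
  then have "real (mu TYPE('a) TYPE('n) t)
      \<le> real_of_int L + real q ^ r - (real q - 1) * (real t - 2) - real_of_int c1 + real_of_int c2"
    by (simp add: c_def D_def Q_def)
  \<comment> \<open>For the second bound, - c1 + c2 \<le> q = (q - 1) + 1 turns t - 2 into t - 3 and
    leaves the 1.\<close>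
  moreover have "real_of_int c2 \<le> real q" "real_of_int c1 \<ge> 0"
    using c2 \<open>0 \<le> c1\<close> by (auto simp: Q_def)
  ultimately show ?thesis
    unfolding L_real by (simp add: algebra_simps)
qed

end
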